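(* Let $D=24009857226825282345490$ and $K=\mathbb Q(\sqrt D)$. Then: (1) $D\equiv 2\pmod 4$, $D$ is squarefree, and its continued fraction is $$\sqrt D=[u_0, \overline{10,2,12,6,1,3,4,3,12,3,4,2,1,6,12,2,10,2u_0}]$$ with $u_0=154951144645$. (2) The element $\alpha_2$ has the largest negative norm among elements of $\mathbb Z[\sqrt D]$, namely $N(\alpha_2)=-N=-N_2=-24548583881$. (3) The element $\alpha_{7,6}$ is an indecomposable integer whose norm is the largest among the norms of all indecomposable integers of $\mathbb Z[\sqrt D]$, and this norm is $N(\alpha_{7,6})=M_7=977608342706$. (4) The smallest nonnegative rational integer $a$ such that $N$ divides $D-a^2$ is $a=4030160489$. (5) With this $a$, $977608342706=M_7>\frac{D-a^2}{N}=M_1=977393040249$. Hence the following assertion (a conjecture of Jang and Kim) is false for $\mathbb Q(\sqrt D)$ with this $D$: "if $a$ is the smallest nonnegative rational integer such that $N$ divides $D-a^2$, then $N(\alpha)\leq \frac{D-a^2}{N}$ for all indecomposable $\alpha\in\mathbb Z[\sqrt D]$."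
   Context: For a squarefree positive integer $D\equiv 2,3\pmod 4$, the ring of integers of $K=\mathbb Q(\sqrt D)$ is $\mathcal O_K=\mathbb Z[\sqrt D]$. For $\alpha=x+y\sqrt D$ with $x,y\in\mathbb Q$, the conjugate is $\alpha'=x-y\sqrt D$ and the norm is $N(\alpha)=\alpha\alpha'=x^2-Dy^2$. An element $\alpha$ is totally positive ($\alpha\succ 0$) if $\alpha>0$ and $\alpha'>0$. A totally positive $\alpha\in\mathcal O_K$ is (additively) indecomposable if there are no totally positive $\beta,\gamma\in\mathcal O_K$ with $\alpha=\beta+\gamma$; "indecomposable integer" means such an element. Write the periodic continued fraction $\sqrt D=[u_0,\overline{u_1,u_2,\dots,u_{s-1},2u_0}]$, with $u_j$ ($j\ge 0$) denoting the $j$-th partial quotient (so $u_s=2u_0$ and the sequence is periodic with period $s$ from $u_1$ on). Put $p_{-1}=1$, $p_0=u_0$, $q_{-1}=0$, $q_0=1$, and $p_{i+1}=u_{i+1}p_i+p_{i-1}$, $q_{i+1}=u_{i+1}q_i+q_{i-1}$ for $i\ge 0$. Define - $\alpha_i=p_i+q_i\sqrt D$ for $i\ge -1$; - $\alpha_{i,r}=\alpha_i+r\alpha_{i+1}$ for $i\ge -1$ and $0\le r\le u_{i+2}$; - $N_i=|N(\alpha_i)|$; - $M_i=N(\alpha_{i,\lfloor u_{i+2}/2\rfloor})$; - $N=\min\{|N(\alpha)| : \alpha\in\mathbb Z[\sqrt D],\ N(\alpha)<0\}$ (the symbol $N$ without argument is this number, $N(\cdot)$ is the norm).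
   Formalization: In part (1) the twelfth entry of the printed period is 2, which is a misprint (the period before 2u_0 must be palindromic, and direct computation gives u_12 = 3); the formal statement has 3 there. *)

theory Defs
  imports Complex_Main "HOL-Computational_Algebra.Computational_Algebra"
begin

section \<open>Real quadratic fields\<close>

text \<open>Elements of the field are real numbers; \<open>D\<close> is meant to be a non-square.\<close>

definition quad_field :: "nat \<Rightarrow> real set" where
  "quad_field D = {x + y * sqrt (real D) | x y. x \<in> \<rat> \<and> y \<in> \<rat>}"

definition quad_order :: "nat \<Rightarrow> real set" where
  "quad_order D = {of_int x + of_int y * sqrt (real D) | x y :: int. True}"

definition ring_of_integers :: "nat \<Rightarrow> real set" where
  "ring_of_integers D = {\<alpha> \<in> quad_field D. algebraic_int \<alpha>}"

definition quad_conj :: "nat \<Rightarrow> real \<Rightarrow> real" where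
  "quad_conj D \<alpha> = (THE \<beta>. \<exists>x y. x \<in> \<rat> \<and> y \<in> \<rat> \<and>
     \<alpha> = x + y * sqrt (real D) \<and> \<beta> = x - y * sqrt (real D))"

definition quad_norm :: "nat \<Rightarrow> real \<Rightarrow> real" where
  "quad_norm D \<alpha> = \<alpha> * quad_conj D \<alpha>"

definition totally_positive :: "nat \<Rightarrow> real \<Rightarrow> bool" where
  "totally_positive D \<alpha> \<longleftrightarrow> \<alpha> > 0 \<and> quad_conj D \<alpha> > 0"

definition indecomposable :: "nat \<Rightarrow> real \<Rightarrow> bool" where
  "indecomposable D \<alpha> \<longleftrightarrow> \<alpha> \<in> ring_of_integers D \<and> totally_positive D \<alpha> \<and>
     \<not> (\<exists>\<beta> \<gamma>. \<beta> \<in> ring_of_integers D \<and> \<gamma> \<in> ring_of_integers D \<and>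
          totally_positive D \<beta> \<and> totally_positive D \<gamma> \<and> \<alpha> = \<beta> + \<gamma>)"

text \<open>Norms of elements of \<open>quad_order D\<close> are integers, so the minimum may be taken over \<open>nat\<close>.\<close>

definition min_neg_norm :: "nat \<Rightarrow> nat" where
  "min_neg_norm D = (LEAST n. \<exists>\<alpha> \<in> quad_order D. quad_norm D \<alpha> < 0 \<and> real n = \<bar>quad_norm D \<alpha>\<bar>)"


section \<open>The continued fraction of the square root\<close>

fun complete_quotient :: "real \<Rightarrow> nat \<Rightarrow> real" where
  "complete_quotient x 0 = x"
| "complete_quotient x (Suc n) = 1 / frac (complete_quotient x n)"

definition partial_quotient :: "real \<Rightarrow> nat \<Rightarrow> int" where
  "partial_quotient x n = \<lfloor>complete_quotient x n\<rfloor>"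

abbreviation sqrt_pq :: "nat \<Rightarrow> nat \<Rightarrow> int" where
  "sqrt_pq D \<equiv> partial_quotient (sqrt (real D))"

text \<open>
  The sequences \<open>conv_num\<close> and \<open>conv_den\<close> are shifted by one: their value at \<open>n\<close> is
  the numerator, respectively denominator, of the convergent with index \<open>n - 1\<close>.  The functions
  below them take the customary index \<open>i \<ge> -1\<close>.
\<close>

fun conv_num :: "nat \<Rightarrow> nat \<Rightarrow> int" where
  "conv_num D 0 = 1"
| "conv_num D (Suc 0) = sqrt_pq D 0"
| "conv_num D (Suc (Suc n)) = sqrt_pq D (Suc n) * conv_num D (Suc n) + conv_num D n"

fun conv_den :: "nat \<Rightarrow> nat \<Rightarrow> int" where
  "conv_den D 0 = 0"
| "conv_den D (Suc 0) = 1"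
| "conv_den D (Suc (Suc n)) = sqrt_pq D (Suc n) * conv_den D (Suc n) + conv_den D n"

definition conv_elem :: "nat \<Rightarrow> int \<Rightarrow> real" where
  "conv_elem D i = of_int (conv_num D (nat (i + 1))) + of_int (conv_den D (nat (i + 1))) * sqrt (real D)"

definition semiconv_elem :: "nat \<Rightarrow> int \<Rightarrow> int \<Rightarrow> real" where
  "semiconv_elem D i r = conv_elem D i + of_int r * conv_elem D (i + 1)"

definition conv_norm :: "nat \<Rightarrow> int \<Rightarrow> real" where
  "conv_norm D i = \<bar>quad_norm D (conv_elem D i)\<bar>"

definition mid_norm :: "nat \<Rightarrow> int \<Rightarrow> real" where
  "mid_norm D i = quad_norm D (semiconv_elem D i (sqrt_pq D (nat (i + 2)) div 2))"


section \<open>The conjectured bound of Jang and Kim\<close>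

definition least_root :: "nat \<Rightarrow> nat \<Rightarrow> bool" where
  "least_root D a \<longleftrightarrow> int (min_neg_norm D) dvd int D - (int a)\<^sup>2 \<and>
     (\<forall>b<a. \<not> int (min_neg_norm D) dvd int D - (int b)\<^sup>2)"

definition jang_kim :: "nat \<Rightarrow> bool" where
  "jang_kim D \<longleftrightarrow> (\<forall>a. least_root D a \<longrightarrow>
     (\<forall>\<alpha>. indecomposable D \<alpha> \<longrightarrow>
        quad_norm D \<alpha> \<le> (real D - (real a)\<^sup>2) / real (min_neg_norm D)))"


section \<open>Basic facts\<close>

lemma quad_coords_unique:
  assumes "sqrt (real D) \<notin> \<rat>"
    and "x \<in> \<rat>" "y \<in> \<rat>" "x' \<in> \<rat>" "y' \<in> \<rat>"
    and "x + y * sqrt (real D) = x' + y' * sqrt (real D)"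
  shows "x = x'" "y = y'"
proof -
  show "y = y'"
  proof (rule ccontr)
    assume "y \<noteq> y'"
    with assms(6) have "sqrt (real D) = (x' - x) / (y - y')" by (simp add: field_simps)
    with assms(1-5) show False by (metis Rats_diff Rats_divide)
  qed
  with assms(6) show "x = x'" by simp
qed

lemma quad_conj_eq:
  assumes "sqrt (real D) \<notin> \<rat>" "x \<in> \<rat>" "y \<in> \<rat>"
  shows "quad_conj D (x + y * sqrt (real D)) = x - y * sqrt (real D)"
  unfolding quad_conj_def
proof (rule the_equality)
  show "\<exists>x' y'. x' \<in> \<rat> \<and> y' \<in> \<rat> \<and> x + y * sqrt (real D) = x' + y' * sqrt (real D) \<and>
          x - y * sqrt (real D) = x' - y' * sqrt (real D)"
    using assms by blast
qed (use quad_coords_unique[OF assms] in metis)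

lemma quad_norm_eq:
  assumes "sqrt (real D) \<notin> \<rat>" "x \<in> \<rat>" "y \<in> \<rat>"
  shows "quad_norm D (x + y * sqrt (real D)) = x\<^sup>2 - real D * y\<^sup>2"
  unfolding quad_norm_def quad_conj_eq[OF assms]
  by (simp add: algebra_simps power2_eq_square)

lemma sqrt_irrational:
  assumes "squarefree D" "D \<noteq> 1"
  shows "sqrt (real D) \<notin> \<rat>"
proof
  assume "sqrt (real D) \<in> \<rat>"
  moreover have "algebraic_int (sqrt (real D))" by (intro algebraic_int_sqrt) simp
  ultimately have "sqrt (real D) \<in> \<int>" by (rule rational_algebraic_int_is_int[rotated])
  then obtain k where k: "sqrt (real D) = of_int k" by (elim Ints_cases)
  then have "k \<ge> 0" by (metis of_int_0_le_iff of_nat_0_le_iff real_sqrt_ge_zero)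
  have "real D = (of_int k)\<^sup>2" using k by (metis of_nat_0_le_iff real_sqrt_pow2)
  also have "\<dots> = real ((nat k)\<^sup>2)" using \<open>k \<ge> 0\<close> by simp
  finally have "D = (nat k)\<^sup>2" by linarith
  with assms show False by (auto simp: squarefree_def dest!: spec[of _ "nat k"])
qed

lemma int_poly_eval:
  fixes \<alpha> :: real and p q :: "int poly"
  shows "poly (map_poly of_int (p + q)) \<alpha> = poly (map_poly of_int p) \<alpha> + poly (map_poly of_int q) \<alpha>"
    and "poly (map_poly of_int (p * q)) \<alpha> = poly (map_poly of_int p) \<alpha> * poly (map_poly of_int q) \<alpha>"
    and "poly (map_poly of_int (smult c p)) \<alpha> = of_int c * poly (map_poly of_int p) \<alpha>"
proof -
  have "map_poly of_int (p + q) = (map_poly of_int p + map_poly of_int q :: real poly)"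
    by (rule poly_eqI) (simp add: coeff_map_poly)
  then show "poly (map_poly of_int (p + q)) \<alpha> = poly (map_poly of_int p) \<alpha> + poly (map_poly of_int q) \<alpha>"
    by simp
  have "map_poly of_int (p * q) = (map_poly of_int p * map_poly of_int q :: real poly)"
    by (rule poly_eqI) (simp add: coeff_map_poly coeff_mult)
  then show "poly (map_poly of_int (p * q)) \<alpha> = poly (map_poly of_int p) \<alpha> * poly (map_poly of_int q) \<alpha>"
    by simp
  have "map_poly of_int (smult c p) = smult (of_int c) (map_poly of_int p :: real poly)"
    by (rule poly_eqI) (simp add: coeff_map_poly)
  then show "poly (map_poly of_int (smult c p)) \<alpha> = of_int c * poly (map_poly of_int p) \<alpha>"
    by simp
qed

lemma primitive_quadratic_lead_coeff:
  fixes m p :: "int poly" and \<alpha> :: real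
  assumes irr: "\<alpha> \<notin> \<rat>"
    and m: "degree m = 2" "content m = 1" "poly (map_poly of_int m) \<alpha> = 0"
    and p: "lead_coeff p = 1" "poly (map_poly of_int p) \<alpha> = 0"
  shows "lead_coeff m dvd 1"
proof -
  obtain q r where qr: "pseudo_divmod p m = (q, r)" by fastforce
  have "m \<noteq> 0" using m(1) by auto
  define c where "c = lead_coeff m ^ (Suc (degree p) - degree m)"
  have eq: "smult c p = m * q + r" and r: "r = 0 \<or> degree r < degree m"
    using pseudo_divmod[OF \<open>m \<noteq> 0\<close> qr] by (auto simp: c_def)
  have "c \<noteq> 0" using \<open>m \<noteq> 0\<close> by (simp add: c_def)
  have root: "poly (map_poly of_int r) \<alpha> = 0"
    using arg_cong[OF eq, of "\<lambda>f. poly (map_poly of_int f) \<alpha>"] m(3) p(2)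
    by (simp add: int_poly_eval)
  have "degree r \<le> 1" using r m(1) by auto
  then have uv: "r = [:u, v:]" if "u = coeff r 0" "v = coeff r 1" for u v
    by (intro poly_eqI) (auto simp: that coeff_pCons coeff_eq_0 split: nat.splits)
  define u v where "u = coeff r 0" and "v = coeff r 1"
  have uv: "r = [:u, v:]" by (rule uv) (simp_all add: u_def v_def)
  have lin: "of_int u + \<alpha> * of_int v = 0" using root by (simp add: uv map_poly_pCons)
  have "v = 0"
  proof (rule ccontr)
    assume "v \<noteq> 0"
    with lin have "\<alpha> = - of_int u / of_int v" by (simp add: field_simps)
    with irr show False by simp
  qed
  with lin uv have "r = 0" by simp
  with eq have eq': "smult c p = m * q" by simp
  have "content p dvd 1" using content_dvd_coeff[of p "degree p"] p(1) by simp
  then have "content p = 1" by (metis is_unit_normalize normalize_content)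
  with arg_cong[OF eq', of content] m(2) have "content q = normalize c"
    by (simp add: content_mult)
  then have "[:c:] dvd q" by (simp add: const_poly_dvd_iff_dvd_content)
  then obtain q' where "q = [:c:] * q'" by (elim dvdE)
  then have "smult c p = smult c (m * q')" using eq' by simp
  with \<open>c \<noteq> 0\<close> have "p = m * q'" using smult_cancel by blast
  then have "lead_coeff m * lead_coeff q' = 1" using p(1) by (simp add: lead_coeff_mult)
  then show ?thesis by (metis dvd_triv_left)
qed

lemma quad_order_subset:
  "quad_order D \<subseteq> ring_of_integers D"
proof
  fix \<alpha> assume "\<alpha> \<in> quad_order D"
  then obtain x y :: int where xy: "\<alpha> = of_int x + of_int y * sqrt (real D)"
    by (auto simp: quad_order_def)
  define p :: "int poly" where "p = [:x\<^sup>2 - int D * y\<^sup>2, - 2 * x, 1:]"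
  have "poly (map_poly of_int p) \<alpha> = (of_int y * sqrt (real D))\<^sup>2 - real D * (of_int y)\<^sup>2"
    by (simp add: p_def xy map_poly_pCons power2_eq_square algebra_simps)
  then have "poly (map_poly of_int p) \<alpha> = 0" by (simp add: power_mult_distrib)
  moreover have "lead_coeff p = 1" by (simp add: p_def)
  ultimately have "algebraic_int \<alpha>" unfolding algebraic_int_altdef_ipoly by blast
  then show "\<alpha> \<in> ring_of_integers D"
    unfolding ring_of_integers_def quad_field_def xy
    by (intro CollectI conjI exI[of _ "of_int x"] exI[of _ "of_int y"]) simp_all
qed

theorem ring_of_integers_eq:
  assumes sf: "squarefree D" and D: "D mod 4 = 2 \<or> D mod 4 = 3"
  shows "ring_of_integers D = quad_order D"
proof (rule antisym[OF _ quad_order_subset], rule subsetI)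
  fix \<alpha> assume "\<alpha> \<in> ring_of_integers D"
  then obtain x y where xy: "x \<in> \<rat>" "y \<in> \<rat>" "\<alpha> = x + y * sqrt (real D)" and int: "algebraic_int \<alpha>"
    by (auto simp: ring_of_integers_def quad_field_def)
  have irr: "sqrt (real D) \<notin> \<rat>" using sf D by (intro sqrt_irrational) auto
  show "\<alpha> \<in> quad_order D"
  proof (cases "y = 0")
    case True
    with xy int have "\<alpha> \<in> \<int>" by (intro rational_algebraic_int_is_int) auto
    then obtain k where "\<alpha> = of_int k" by (elim Ints_cases)
    then have "\<alpha> = of_int k + of_int 0 * sqrt (real D)" by simp
    then show ?thesis unfolding quad_order_def by blast
  next
    case False
    have \<alpha>_irr: "\<alpha> \<notin> \<rat>"
    proof
      assume "\<alpha> \<in> \<rat>"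
      moreover have "x + y * sqrt (real D) = \<alpha> + 0 * sqrt (real D)" using xy(3) by simp
      ultimately have "y = 0" using quad_coords_unique(2)[OF irr xy(1,2)] Rats_0 by metis
      with False show False ..
    qed
    obtain a1 b1 where x: "x = of_int a1 / of_int b1" "b1 > 0"
      by (rule Rats_cases'[OF xy(1)])
    obtain a2 b2 where y: "y = of_int a2 / of_int b2" "b2 > 0"
      by (rule Rats_cases'[OF xy(2)])
    define d a b where "d = b1 * b2" and "a = a1 * b2" and "b = a2 * b1"
    have "d > 0" using x y by (simp add: d_def)
    have xd: "x = of_int a / of_int d" and yd: "y = of_int b / of_int d"
      using x y by (simp_all add: d_def a_def b_def)
    have \<alpha>: "of_int d * \<alpha> = of_int a + of_int b * sqrt (real D)"
      using \<open>d > 0\<close> by (simp add: xy(3) xd yd field_simps)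
    define f :: "int poly" where "f = [:a\<^sup>2 - int D * b\<^sup>2, - 2 * a * d, d\<^sup>2:]"
    have f0: "poly (map_poly of_int f) \<alpha> = 0"
    proof -
      have "poly (map_poly of_int f) \<alpha> = (of_int d * \<alpha> - of_int a)\<^sup>2 - real D * (of_int b)\<^sup>2"
        by (simp add: f_def map_poly_pCons power2_eq_square algebra_simps)
      also have "\<dots> = 0" by (simp add: \<alpha> power_mult_distrib)
      finally show ?thesis .
    qed
    define m where "m = primitive_part f"
    define g where "g = content f"
    have fm: "f = smult g m" by (simp add: m_def g_def)
    have degf: "degree f = 2" and "f \<noteq> 0" using \<open>d > 0\<close> by (auto simp: f_def)
    then have "g \<noteq> 0" by (simp add: g_def)
    obtain p :: "int poly" where p: "poly (map_poly of_int p) \<alpha> = 0" "lead_coeff p = 1"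
      using int by (auto simp: algebraic_int_altdef_ipoly)
    have "lead_coeff m dvd 1"
    proof (rule primitive_quadratic_lead_coeff[OF \<alpha>_irr _ _ _ p(2,1)])
      show "degree m = 2" using degf \<open>g \<noteq> 0\<close> fm by simp
      show "content m = 1" using \<open>f \<noteq> 0\<close> by (simp add: m_def)
      show "poly (map_poly of_int m) \<alpha> = 0" using f0 \<open>g \<noteq> 0\<close> by (simp add: fm int_poly_eval)
    qed
    moreover have "d\<^sup>2 = g * lead_coeff m"
      using arg_cong[OF fm, of lead_coeff] degf \<open>d > 0\<close> by (simp add: f_def)
    ultimately have dg: "d\<^sup>2 dvd g" by (metis dvd_mult_unit_iff dvd_refl)
    have "g dvd coeff f 0" "g dvd coeff f 1" by (simp_all only: g_def content_dvd_coeff)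
    then have dn: "d\<^sup>2 dvd a\<^sup>2 - int D * b\<^sup>2" and dt: "d\<^sup>2 dvd 2 * a * d"
      using dg by (auto simp: f_def intro: dvd_trans)
    from dt have "d dvd 2 * a" using \<open>d > 0\<close> by (simp add: power2_eq_square)
    then obtain t where t: "2 * a = d * t" by (elim dvdE)
    obtain n where n: "a\<^sup>2 - int D * b\<^sup>2 = d\<^sup>2 * n" using dn by (elim dvdE)
    have "(2 * a)\<^sup>2 - int D * (2 * b)\<^sup>2 = 4 * (d\<^sup>2 * n)" by (simp flip: n add: power_mult_distrib)
    then have eq: "int D * (2 * b)\<^sup>2 = d\<^sup>2 * (t\<^sup>2 - 4 * n)"
      unfolding t by (simp add: algebra_simps power_mult_distrib)
    have "d dvd 2 * b"
    proof -
      obtain b' d' where bd: "2 * b = b' * gcd (2 * b) d" "d = d' * gcd (2 * b) d" "coprime b' d'"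
        using gcd_coprime_exists[of "2 * b" d] \<open>d > 0\<close> by auto
      define h where "h = gcd (2 * b) d"
      have "h \<noteq> 0" using \<open>d > 0\<close> by (simp add: h_def)
      have "int D * (b' * h)\<^sup>2 = (d' * h)\<^sup>2 * (t\<^sup>2 - 4 * n)" using eq bd(1,2) unfolding h_def by metis
      then have "int D * b'\<^sup>2 = d'\<^sup>2 * (t\<^sup>2 - 4 * n)" using \<open>h \<noteq> 0\<close> by (simp add: power_mult_distrib)
      then have "d'\<^sup>2 dvd int D * b'\<^sup>2" by (metis dvd_triv_left)
      moreover have "coprime (d'\<^sup>2) (b'\<^sup>2)" using bd(3) by (simp add: coprime_commute)
      ultimately have "d'\<^sup>2 dvd int D" by (simp add: coprime_dvd_mult_left_iff)
      then have "(nat \<bar>d'\<bar>)\<^sup>2 dvd D"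
        by (metis int_dvd_int_iff nat_0_le abs_ge_zero of_nat_power power2_abs)
      with sf have "\<bar>d'\<bar> = 1" by (auto simp: squarefree_def)
      then have "d dvd h" using bd(2) unfolding h_def by (metis abs_mult abs_ge_zero abs_dvd_iff dvd_abs_iff dvd_refl mult_1)
      then show ?thesis by (simp add: h_def)
    qed
    then obtain w where w: "2 * b = d * w" by (elim dvdE)
    have "int D * w\<^sup>2 = t\<^sup>2 - 4 * n"
    proof -
      have "d\<^sup>2 * (int D * w\<^sup>2) = d\<^sup>2 * (t\<^sup>2 - 4 * n)"
        using eq unfolding w by (simp add: power_mult_distrib)
      with \<open>d > 0\<close> show ?thesis by (simp del: mult_cancel_left add: mult_left_cancel)
    qed
    then have mod4: "4 dvd t\<^sup>2 - int D * w\<^sup>2" by simp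
    have D': "int D mod 4 = 2 \<or> int D mod 4 = 3" using D by presburger
    have "even t \<and> even w"
    proof -
      have sq: "z\<^sup>2 mod 4 = (if even z then 0 else 1)" for z :: int
      proof (cases "even z")
        case True
        then show ?thesis by (auto elim!: evenE simp: power_mult_distrib)
      next
        case False
        then obtain k where "z = 2 * k + 1" by (elim oddE)
        then have "z\<^sup>2 = 4 * (k\<^sup>2 + k) + 1" by (simp add: power2_eq_square algebra_simps)
        with False show ?thesis by presburger
      qed
      have "t\<^sup>2 mod 4 = (int D mod 4) * (w\<^sup>2 mod 4) mod 4"
        using mod4 by (simp add: mod_eq_dvd_iff mod_mult_eq)
      with D' show ?thesis by (auto simp: sq split: if_splits)
    qed
    then obtain t' w' where "t = 2 * t'" "w = 2 * w'" by (auto elim!: evenE)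
    with t w have "a = d * t'" "b = d * w'" by simp_all
    with xy(3) xd yd \<open>d > 0\<close> show ?thesis
      unfolding quad_order_def
      by (intro CollectI exI[of _ t'] exI[of _ w']) simp
  qed
qed

end

theory Submission
  imports Defs "HOL-Number_Theory.Pocklington" "HOL-Number_Theory.Mod_Exp"
begin

text \<open>
  Everything rests on one duality.  Call \<open>\<beta>\<close> a companion of the totally positive \<open>\<alpha>\<close> if \<open>N(\<beta>) < 0\<close> and the
  coordinate vectors of \<open>\<alpha>\<close> and \<open>\<beta>\<close> have determinant 1.  If \<open>D\<close> is squarefree and congruent to 2 or 3
  modulo 4, then \<open>\<alpha>\<close> is indecomposable if and only if it has a companion (\<open>not_decomposable\<close>,
  \<open>negative_companion\<close>).  By Brahmagupta's identity, \<open>N(\<alpha>) \<bar>N(\<beta>)\<bar> = D - m\<^sup>2\<close> for an integer \<open>m\<close>, half the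
  trace of \<open>\<alpha>\<beta>'\<close>.  So indecomposable elements of large norm belong to negative norms that are small in
  absolute value, and the size of \<open>m\<close>, which is a square root of \<open>D\<close> modulo \<open>N(\<beta>)\<close>, decides how close
  \<open>N(\<alpha>)\<close> comes to \<open>D / \<bar>N(\<beta>)\<bar>\<close>.

  For the \<open>D\<close> at hand, the negative norms of smallest absolute values are \<open>-N = -24548583881\<close>, the norm
  of \<open>\<alpha>\<^sub>2\<close>, and \<open>-K = -24559791665\<close>, the norm of \<open>\<alpha>\<^sub>8\<close>, which is only slightly larger in absolute value.
  This is read off from the continued fraction (\<open>negative_norm_value\<close>): Euclid's algorithm, run on
  the coordinates with respect to consecutive convergents, brings every element of negative norm into
  a cone between two convergents, on which the norm is explicitly bounded.

  Now the two candidates compete.  \<open>N\<close> is prime, so the square roots of \<open>D\<close> modulo \<open>N\<close> are \<open>\<plusminus>a\<close> with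
  \<open>a = 4030160489\<close>, and a companion of norm \<open>-N\<close> gives \<open>N(\<alpha>) \<le> (D - a\<^sup>2) / N\<close>.  But \<open>K\<close> divides \<open>D\<close>, so for
  companions of norm \<open>-K\<close> the value \<open>m = 0\<close> is possible; it occurs for \<open>\<alpha>\<^bsub>7,6\<^esub>\<close> and its companion \<open>\<alpha>\<^sub>8\<close>, and
  \<open>N(\<alpha>\<^bsub>7,6\<^esub>) = D / K\<close> exceeds \<open>(D - a\<^sup>2) / N\<close>, since \<open>a\<close> is large and \<open>K\<close> is close to \<open>N\<close>.
\<close>

section \<open>Indecomposable elements and their companions\<close>

definition tot_pos :: "nat \<Rightarrow> int \<Rightarrow> int \<Rightarrow> bool" where
  "tot_pos D x y \<longleftrightarrow> 0 < x \<and> int D * y\<^sup>2 < x\<^sup>2"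

lemma nonsquare:
  assumes "sqrt (real D) \<notin> \<rat>" "x\<^sup>2 = int D * y\<^sup>2"
  shows "x = 0 \<and> y = 0"
proof -
  have "y = 0"
  proof (rule ccontr)
    assume "y \<noteq> 0"
    have "(of_int x)\<^sup>2 = real D * (of_int y)\<^sup>2"
      using arg_cong[OF assms(2), of real_of_int] by simp
    then have "real D = (of_int \<bar>x\<bar> / of_int \<bar>y\<bar>)\<^sup>2"
      using \<open>y \<noteq> 0\<close> by (simp add: power_divide)
    then have "sqrt (real D) = of_int \<bar>x\<bar> / of_int \<bar>y\<bar>"
      by (simp del: power_divide)
    with assms(1) show False by simp
  qed
  with assms(2) show ?thesis by simp
qed

lemma quad_norm_int:
  assumes "sqrt (real D) \<notin> \<rat>"
  shows "quad_norm D (of_int x + of_int y * sqrt (real D)) = of_int (x\<^sup>2 - int D * y\<^sup>2)"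
  using quad_norm_eq[OF assms, of "of_int x" "of_int y"] by simp

lemma totally_positive_int:
  assumes "sqrt (real D) \<notin> \<rat>"
  shows "totally_positive D (of_int x + of_int y * sqrt (real D)) \<longleftrightarrow> tot_pos D x y"
proof -
  define a b :: real where "a = of_int x" and "b = of_int y * sqrt (real D)"
  have "b\<^sup>2 = of_int (int D * y\<^sup>2)" by (simp add: b_def power_mult_distrib)
  moreover have "a\<^sup>2 = of_int (x\<^sup>2)" by (simp add: a_def)
  ultimately have sq: "int D * y\<^sup>2 < x\<^sup>2 \<longleftrightarrow> b\<^sup>2 < a\<^sup>2" by (simp only: of_int_less_iff)
  have "totally_positive D (a + b) \<longleftrightarrow> a + b > 0 \<and> a - b > 0"
    using quad_conj_eq[OF assms, of "of_int x" "of_int y"]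
    by (simp add: totally_positive_def a_def b_def)
  also have "\<dots> \<longleftrightarrow> a > 0 \<and> \<bar>b\<bar> < \<bar>a\<bar>" by linarith
  also have "\<dots> \<longleftrightarrow> a > 0 \<and> b\<^sup>2 < a\<^sup>2" using abs_le_square_iff[of a b] by (auto simp: not_le [symmetric])
  finally show ?thesis by (simp add: tot_pos_def sq a_def b_def)
qed

text \<open>
  The residue of \<open>D\<close> modulo 4 matters here: for \<open>D mod 4 = 1\<close> the summands of a decomposition may have
  half-integer coordinates.
\<close>

lemma indecomposable_int:
  assumes "squarefree D" "D mod 4 = 2 \<or> D mod 4 = 3"
  shows "indecomposable D (of_int x + of_int y * sqrt (real D)) \<longleftrightarrow>
     tot_pos D x y \<and> \<not> (\<exists>a b. tot_pos D a b \<and> tot_pos D (x - a) (y - b))"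
    (is "indecomposable D ?\<alpha> \<longleftrightarrow> _")
proof -
  have irr: "sqrt (real D) \<notin> \<rat>" using assms by (intro sqrt_irrational) auto
  have "(\<exists>\<beta> \<gamma>. \<beta> \<in> quad_order D \<and> \<gamma> \<in> quad_order D \<and>
          totally_positive D \<beta> \<and> totally_positive D \<gamma> \<and> ?\<alpha> = \<beta> + \<gamma>)
     \<longleftrightarrow> (\<exists>a b. tot_pos D a b \<and> tot_pos D (x - a) (y - b))" (is "?L \<longleftrightarrow> ?R")
  proof
    assume ?L
    then obtain a b c d where *: "tot_pos D a b" "tot_pos D c d"
      "?\<alpha> = (of_int a + of_int b * sqrt (real D)) + (of_int c + of_int d * sqrt (real D))"
      by (auto simp: quad_order_def totally_positive_int[OF irr])
    then have "?\<alpha> = of_int (a + c) + of_int (b + d) * sqrt (real D)"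
      by (simp add: algebra_simps)
    from quad_coords_unique[OF irr _ _ _ _ this]
    have "x = a + c" "y = b + d" by (simp_all flip: of_int_add)
    with * show ?R by (intro exI[of _ a] exI[of _ b]) simp
  next
    assume ?R
    then obtain a b where "tot_pos D a b" "tot_pos D (x - a) (y - b)" by blast
    then have "totally_positive D (of_int a + of_int b * sqrt (real D))"
      "totally_positive D (of_int (x - a) + of_int (y - b) * sqrt (real D))"
      by (simp_all only: totally_positive_int[OF irr])
    moreover have "?\<alpha> = (of_int a + of_int b * sqrt (real D)) +
        (of_int (x - a) + of_int (y - b) * sqrt (real D))" by (simp add: algebra_simps)
    ultimately show ?L unfolding quad_order_def by blast
  qed
  moreover have "?\<alpha> \<in> quad_order D" by (auto simp: quad_order_def)
  ultimately show ?thesis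
    by (simp add: indecomposable_def ring_of_integers_eq[OF assms] totally_positive_int[OF irr])
qed

text \<open>
  The expression is half the trace of \<open>\<alpha>\<beta>'\<close>, and \<open>\<alpha>\<beta>'\<close> is totally positive when \<open>\<alpha>\<close> and \<open>\<beta>\<close> are.
\<close>

lemma tot_pos_trace_pos:
  assumes "tot_pos D x y" "tot_pos D a b"
  shows "0 < x * a - int D * y * b"
proof -
  have "(int D * y * b)\<^sup>2 = (int D * y\<^sup>2) * (int D * b\<^sup>2)"
    by (simp add: power2_eq_square algebra_simps)
  also have "\<dots> \<le> x\<^sup>2 * (int D * b\<^sup>2)"
    using assms by (intro mult_right_mono) (auto simp: tot_pos_def)
  also have "\<dots> < x\<^sup>2 * a\<^sup>2"
    using assms by (intro mult_strict_left_mono) (auto simp: tot_pos_def)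
  finally have "(int D * y * b)\<^sup>2 < (x * a)\<^sup>2" by (simp add: power_mult_distrib)
  moreover have "0 \<le> x * a" using assms by (simp add: tot_pos_def)
  ultimately have "int D * y * b < x * a" by (rule power2_less_imp_less)
  then show ?thesis by simp
qed

text \<open>
  The line through an element of negative norm meets the cone of totally positive elements only in
  the origin, so the determinant with such an element has a constant sign on that cone.
\<close>

lemma tot_pos_det_pos:
  assumes "tot_pos D x y" "p\<^sup>2 < int D * q\<^sup>2" "0 < q"
  shows "0 < x * q - y * p"
proof -
  have "(y * p)\<^sup>2 \<le> y\<^sup>2 * (int D * q\<^sup>2)"
    using assms(2) by (simp add: power_mult_distrib mult_left_mono)
  also have "\<dots> = (int D * y\<^sup>2) * q\<^sup>2" by (simp add: algebra_simps)
  also have "\<dots> < x\<^sup>2 * q\<^sup>2" using assms by (intro mult_strict_right_mono) (auto simp: tot_pos_def)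
  finally have "(y * p)\<^sup>2 < (x * q)\<^sup>2" by (simp add: power_mult_distrib)
  moreover have "0 \<le> x * q" using assms by (simp add: tot_pos_def)
  ultimately have "y * p < x * q" by (rule power2_less_imp_less)
  then show ?thesis by simp
qed

text \<open>
  The determinant with an element of negative norm is a linear form which takes nonzero integer
  values of one sign on the totally positive elements.  Where it has absolute value 1, it cannot be
  split into two such values.
\<close>

lemma not_decomposable:
  assumes det: "\<bar>x * q - y * p\<bar> = 1" and neg: "p\<^sup>2 < int D * q\<^sup>2"
    and "tot_pos D a b" "tot_pos D (x - a) (y - b)"
  shows False
proof -
  have *: False if "0 < q'" "p'\<^sup>2 < int D * q'\<^sup>2" "\<bar>x * q' - y * p'\<bar> = 1" for p' q'
    using tot_pos_det_pos[OF assms(3) that(2,1)] tot_pos_det_pos[OF assms(4) that(2,1)] that(3)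
    by (simp add: algebra_simps)
  have "q \<noteq> 0" using neg by auto
  then show False
    using *[of q p] *[of "-q" "-p"] det neg by (cases "0 < q") (auto simp: abs_if split: if_splits)
qed

text \<open>
  This identity turns determinant 1 into \<open>N(\<alpha>) \<bar>N(\<beta>)\<bar> = D - m\<^sup>2\<close> whenever \<open>N(\<beta>) < 0\<close>.
\<close>

lemma brahmagupta:
  fixes x y p q :: int
  shows "(x\<^sup>2 - d * y\<^sup>2) * (p\<^sup>2 - d * q\<^sup>2) = (x * p - d * y * q)\<^sup>2 - d * (x * q - y * p)\<^sup>2"
  by (simp add: power2_eq_square algebra_simps)

lemma centered_residue:
  fixes m A :: int
  assumes "0 < A"
  obtains k where "2 * \<bar>m + k * A\<bar> \<le> A"
proof
  define k where "k = - ((2 * m + A) div (2 * A))"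
  have "2 * m + A = (2 * A) * (- k) + (2 * m + A) mod (2 * A)" by (simp add: k_def)
  moreover have "0 \<le> (2 * m + A) mod (2 * A)" "(2 * m + A) mod (2 * A) < 2 * A"
    using assms by simp_all
  ultimately have "0 \<le> 2 * (m + k * A) + A" "2 * (m + k * A) + A < 2 * A"
    by (simp_all add: algebra_simps)
  then show "2 * \<bar>m + k * A\<bar> \<le> A" by linarith
qed

text \<open>
  The converse of \<open>not_decomposable\<close>.  An indecomposable \<open>\<alpha>\<close> is primitive, so some \<open>\<beta>\<close> has
  determinant 1 with it, and \<open>\<beta>\<close> may be changed by multiples of \<open>\<alpha>\<close> until half the trace \<open>m\<close> of \<open>\<alpha>\<beta>'\<close>
  satisfies \<open>2\<bar>m\<bar> \<le> N(\<alpha>)\<close>.  If \<open>N(\<beta>)\<close> were positive, then \<open>\<beta>\<close> or \<open>-\<beta>\<close> would be totally positive; call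
  it \<open>\<gamma>\<close>.  As \<open>N(\<alpha> - \<gamma>) = N(\<alpha>) - 2\<bar>m\<bar> + N(\<gamma>) > 0\<close>, the element \<open>\<alpha> - \<gamma>\<close> would be totally positive as
  well, and \<open>\<alpha> = \<gamma> + (\<alpha> - \<gamma>)\<close> would be a decomposition.
\<close>

lemma negative_companion:
  assumes irr: "sqrt (real D) \<notin> \<rat>" and tp: "tot_pos D x y"
    and ind: "\<not> (\<exists>a b. tot_pos D a b \<and> tot_pos D (x - a) (y - b))"
  obtains p q where "p\<^sup>2 < int D * q\<^sup>2" "x * q - y * p = 1"
proof -
  define A where "A = x\<^sup>2 - int D * y\<^sup>2"
  have "A > 0" and "x > 0" using tp by (auto simp: A_def tot_pos_def)
  \<comment> \<open>A multiple \<open>d\<alpha>\<^sub>0\<close> with \<open>d \<ge> 2\<close> decomposes as \<open>\<alpha>\<^sub>0 + (d - 1)\<alpha>\<^sub>0\<close>.\<close>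
  have "coprime x y"
  proof (rule ccontr)
    assume "\<not> coprime x y"
    define d where "d = gcd x y"
    have "d > 0" "d \<noteq> 1" using \<open>x > 0\<close> \<open>\<not> coprime x y\<close> by (auto simp: d_def coprime_iff_gcd_eq_1)
    obtain a b where ab: "x = d * a" "y = d * b"
      unfolding d_def by (metis gcd_dvd1 gcd_dvd2 dvdE)
    have "a > 0" using ab \<open>x > 0\<close> \<open>d > 0\<close> by (simp add: zero_less_mult_iff)
    moreover have "d\<^sup>2 * (int D * b\<^sup>2) < d\<^sup>2 * a\<^sup>2"
      using tp by (simp add: tot_pos_def ab algebra_simps power_mult_distrib)
    ultimately have D_ab: "int D * b\<^sup>2 < a\<^sup>2" "a > 0" using \<open>d > 0\<close> by simp_all
    have "d - 1 > 0" using \<open>d > 0\<close> \<open>d \<noteq> 1\<close> by linarith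
    have "int D * ((d - 1) * b)\<^sup>2 = (d - 1)\<^sup>2 * (int D * b\<^sup>2)"
      by (simp only: power_mult_distrib mult.left_commute)
    also have "\<dots> < (d - 1)\<^sup>2 * a\<^sup>2"
      using D_ab \<open>d - 1 > 0\<close> by (intro mult_strict_left_mono) auto
    also have "\<dots> = ((d - 1) * a)\<^sup>2" by (simp only: power_mult_distrib)
    finally have "tot_pos D ((d - 1) * a) ((d - 1) * b)"
      using D_ab \<open>d - 1 > 0\<close> by (simp add: tot_pos_def)
    moreover have "tot_pos D a b" using D_ab by (simp add: tot_pos_def)
    ultimately show False using ind by (auto simp: ab algebra_simps)
  qed
  then obtain u v where "u * x + v * y = 1" by (metis bezout_int coprime_iff_gcd_eq_1)
  define p0 q0 where "p0 = - v" and "q0 = u"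
  have det0: "x * q0 - y * p0 = 1" using \<open>u * x + v * y = 1\<close> by (simp add: p0_def q0_def algebra_simps)
  obtain k where k: "2 * \<bar>(x * p0 - int D * y * q0) + k * A\<bar> \<le> A"
    using centered_residue[OF \<open>A > 0\<close>] .
  define p q where "p = p0 + k * x" and "q = q0 + k * y"
  have det: "x * q - y * p = 1" using det0 by (simp add: p_def q_def algebra_simps)
  define t where "t = x * p - int D * y * q"
  have "2 * \<bar>t\<bar> \<le> A"
    using k by (simp add: t_def p_def q_def A_def algebra_simps power2_eq_square)
  then have "2 * t \<le> A" "2 * (- t) \<le> A" by simp_all
  then have half: "2 * (x * p - int D * y * q) \<le> A" "2 * (x * (- p) - int D * y * (- q)) \<le> A"
    by (simp_all add: t_def)
  have "\<not> int D * q\<^sup>2 < p\<^sup>2"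
  proof
    assume pos: "int D * q\<^sup>2 < p\<^sup>2"
    obtain a b where ab: "tot_pos D a b" "2 * (x * a - int D * y * b) \<le> A"
    proof (cases "0 < p")
      case True
      with pos half show ?thesis by (intro that[of p q]) (auto simp: tot_pos_def)
    next
      case False
      moreover have "p \<noteq> 0" using pos by (auto simp: mult_less_0_iff)
      ultimately show ?thesis using pos half by (intro that[of "-p" "-q"]) (auto simp: tot_pos_def)
    qed
    define m where "m = x * a - int D * y * b"
    have "m > 0" using tot_pos_trace_pos[OF tp ab(1)] by (simp add: m_def)
    have norm: "(x - a)\<^sup>2 - int D * (y - b)\<^sup>2 = A - 2 * m + (a\<^sup>2 - int D * b\<^sup>2)"
      by (simp add: A_def m_def power2_eq_square algebra_simps)
    then have pos': "int D * (y - b)\<^sup>2 < (x - a)\<^sup>2" using ab by (simp add: tot_pos_def m_def)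
    \<comment> \<open>Otherwise \<open>-(\<alpha> - \<gamma>)\<close> is totally positive, and its trace pairing \<open>m - N(\<alpha>)\<close> with \<open>\<alpha>\<close> is positive,
          contrary to \<open>2m \<le> N(\<alpha>)\<close>.\<close>
    have "x - a > 0"
    proof (rule ccontr)
      assume "\<not> x - a > 0"
      moreover have "x - a \<noteq> 0" using pos' by (auto simp: mult_less_0_iff)
      ultimately have "tot_pos D (a - x) (b - y)"
        using pos' by (simp add: tot_pos_def power2_commute)
      from tot_pos_trace_pos[OF tp this] have "A < m"
        by (simp add: A_def m_def power2_eq_square algebra_simps)
      with ab(2) \<open>A > 0\<close> show False by (simp add: m_def)
    qed
    with pos' have "tot_pos D (x - a) (y - b)" by (simp add: tot_pos_def)
    with ab(1) ind show False by blast
  qed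
  moreover have "p\<^sup>2 \<noteq> int D * q\<^sup>2" using nonsquare[OF irr] det by fastforce
  ultimately have "p\<^sup>2 < int D * q\<^sup>2" by linarith
  with det show thesis using that by blast
qed

text \<open>
  The norms of indecomposable elements are governed by the negative norms: here the last
  equation bounds \<open>A\<close> by \<open>D\<close> divided by a negative norm, with a correction \<open>m\<^sup>2\<close> that is prescribed
  modulo this norm.
\<close>

lemma indecomposable_norm_factor:
  assumes "squarefree D" "D mod 4 = 2 \<or> D mod 4 = 3" "indecomposable D \<alpha>"
  obtains A m x y :: int where "quad_norm D \<alpha> = of_int A" "0 < A" "x\<^sup>2 < int D * y\<^sup>2"
    "A * (int D * y\<^sup>2 - x\<^sup>2) = int D - m\<^sup>2"
proof -
  have irr: "sqrt (real D) \<notin> \<rat>" using assms by (intro sqrt_irrational) auto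
  have "\<alpha> \<in> quad_order D"
    using assms(3) ring_of_integers_eq[OF assms(1,2)] by (simp add: indecomposable_def)
  then obtain a b :: int where \<alpha>: "\<alpha> = of_int a + of_int b * sqrt (real D)"
    by (auto simp: quad_order_def)
  have tp: "tot_pos D a b" "\<not> (\<exists>c d. tot_pos D c d \<and> tot_pos D (a - c) (b - d))"
    using assms(3) unfolding \<alpha> indecomposable_int[OF assms(1,2)] by blast+
  obtain p q where pq: "p\<^sup>2 < int D * q\<^sup>2" "a * q - b * p = 1"
    using negative_companion[OF irr tp] .
  have "(a\<^sup>2 - int D * b\<^sup>2) * (int D * q\<^sup>2 - p\<^sup>2) = int D - (a * p - int D * b * q)\<^sup>2"
    using brahmagupta[of a "int D" b p q] pq(2) by (simp add: algebra_simps)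
  then show thesis
    using tp(1) pq(1) by (intro that[of "a\<^sup>2 - int D * b\<^sup>2" p q])
      (auto simp only: \<alpha> quad_norm_int[OF irr] tot_pos_def)
qed

section \<open>The norm form along the continued fraction\<close>

lemma floor_sqrt_bounds:
  fixes s :: int
  assumes "0 \<le> s" "s\<^sup>2 < int D" "int D < (s + 1)\<^sup>2"
  shows "of_int s < sqrt (real D)" "sqrt (real D) < of_int s + 1"
proof -
  have "real_of_int (s\<^sup>2) < of_int (int D)" "real_of_int (int D) < of_int ((s + 1)\<^sup>2)"
    using assms by (simp_all only: of_int_less_iff)
  then have "(of_int s)\<^sup>2 < real D" "real D < (of_int s + 1)\<^sup>2" by simp_all
  then show "of_int s < sqrt (real D)" "sqrt (real D) < of_int s + 1"
    using assms(1) by (auto intro: real_less_rsqrt real_less_lsqrt)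
qed

text \<open>
  The integers of the classical algorithm for a quadratic surd: the complete quotient with index \<open>i\<close> is
  \<open>(P\<^sub>i + \<surd>D) / Q\<^sub>i\<close>.  With \<open>s = \<lfloor>\<surd>D\<rfloor>\<close>, the last two assumptions say in integers that \<open>u\<^sub>i\<close> is its
  floor.
\<close>

locale sqrt_expansion =
  fixes D :: nat and s :: int and P Q u :: "nat \<Rightarrow> int"
  assumes s_nonneg: "0 \<le> s" and s_lower: "s\<^sup>2 < int D" and s_upper: "int D < (s + 1)\<^sup>2"
    and P_0: "P 0 = 0" and Q_0: "Q 0 = 1"
    and P_Suc: "P (Suc i) = u i * Q i - P i"
    and Q_Suc: "Q i * Q (Suc i) = int D - (P (Suc i))\<^sup>2"
    and Q_pos: "0 < Q i"
    and P_le: "P (Suc i) \<le> s" and P_gt: "s < P (Suc i) + Q i"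
begin

lemma P_1: "P (Suc 0) = s"
  using P_le[of 0] P_gt[of 0] by (simp add: Q_0)

lemma partial_quotient_step:
  fixes i :: nat
  defines "\<xi> \<equiv> (of_int (P i) + sqrt (real D)) / of_int (Q i)"
  shows "\<lfloor>\<xi>\<rfloor> = u i"
    and "1 / frac \<xi> = (of_int (P (Suc i)) + sqrt (real D)) / of_int (Q (Suc i))"
proof -
  note s = floor_sqrt_bounds[OF s_nonneg s_lower s_upper]
  have Q: "(0::real) < of_int (Q i)" "(0::real) < of_int (Q (Suc i))" using Q_pos by simp_all
  have P: "of_int (u i) * of_int (Q i) = (of_int (P (Suc i)) + of_int (P i) :: real)"
    using arg_cong[OF P_Suc[of i], of real_of_int] by simp
  have lower: "of_int (P (Suc i)) < sqrt (real D)"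
    using P_le[of i] s(1) by linarith
  have "s + 1 \<le> P (Suc i) + Q i" using P_gt[of i] by simp
  then have "real_of_int (s + 1) \<le> of_int (P (Suc i) + Q i)" by (simp only: of_int_le_iff)
  then have "sqrt (real D) < of_int (P (Suc i)) + of_int (Q i)" using s(2) by simp
  then have "of_int (u i) \<le> \<xi>" "\<xi> < of_int (u i) + 1"
    using lower P Q(1) by (simp_all add: \<xi>_def field_simps)
  then show floor: "\<lfloor>\<xi>\<rfloor> = u i" by (simp add: floor_eq_iff)
  have "frac \<xi> = (sqrt (real D) - of_int (P (Suc i))) / of_int (Q i)"
    using P Q(1) by (simp add: frac_def floor) (simp add: \<xi>_def field_simps)
  moreover have "of_int (Q i) * of_int (Q (Suc i)) =
      (sqrt (real D) - of_int (P (Suc i))) * (sqrt (real D) + of_int (P (Suc i)))"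
    using arg_cong[OF Q_Suc[of i], of real_of_int]
    by (simp add: algebra_simps power2_eq_square)
  ultimately show "1 / frac \<xi> = (of_int (P (Suc i)) + sqrt (real D)) / of_int (Q (Suc i))"
    using lower Q by (simp add: frac_eq_eq ac_simps del: of_int_mult flip: of_int_mult)
qed

lemma complete_quotient_eq:
  "complete_quotient (sqrt (real D)) i = (of_int (P i) + sqrt (real D)) / of_int (Q i)"
  by (induction i) (simp_all add: P_0 Q_0 partial_quotient_step(2))

lemma sqrt_pq_eq: "sqrt_pq D i = u i"
  by (simp add: partial_quotient_def complete_quotient_eq partial_quotient_step(1))

lemma Q_Suc_Suc: "Q (Suc (Suc i)) = Q i + u (Suc i) * (P (Suc i) - P (Suc (Suc i)))"
proof -
  have "Q (Suc i) * Q (Suc (Suc i)) = Q (Suc i) * (Q i + u (Suc i) * (P (Suc i) - P (Suc (Suc i))))"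
    using Q_Suc[of i] Q_Suc[of "Suc i"] P_Suc[of "Suc i"] by Groebner_Basis.algebra
  then show ?thesis using Q_pos[of "Suc i"] by simp
qed

text \<open>
  The convergents \<open>\<alpha>\<^bsub>i-1\<^esub>, \<alpha>\<^sub>i\<close> form a basis of \<open>\<int>[\<surd>D]\<close>, in which the norm form has coefficients
  \<open>Q\<^sub>i, 2P\<^bsub>i+1\<^esub>, -Q\<^bsub>i+1\<^esub>\<close> up to sign.  The values of \<open>conv_num\<close> and \<open>conv_den\<close> at \<open>i\<close> are the
  coordinates of \<open>\<alpha>\<^bsub>i-1\<^esub>\<close>.
\<close>

lemma convergent_invariants:
  fixes i :: nat
  defines "A \<equiv> conv_num D i" and "B \<equiv> conv_den D i"
    and "A' \<equiv> conv_num D (Suc i)" and "B' \<equiv> conv_den D (Suc i)"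
  shows "A\<^sup>2 - int D * B\<^sup>2 = (-1) ^ i * Q i"
    and "A * A' - int D * B * B' = (-1) ^ i * P (Suc i)"
    and "A * B' - B * A' = (-1) ^ i"
    and "A'\<^sup>2 - int D * B'\<^sup>2 = (-1) ^ Suc i * Q (Suc i)"
proof -
  have "A\<^sup>2 - int D * B\<^sup>2 = (-1) ^ i * Q i
    \<and> A * A' - int D * B * B' = (-1) ^ i * P (Suc i)
    \<and> A * B' - B * A' = (-1) ^ i
    \<and> A'\<^sup>2 - int D * B'\<^sup>2 = (-1) ^ Suc i * Q (Suc i)"
    unfolding A_def B_def A'_def B'_def
  proof (induction i)
    case 0
    then show ?case using P_1 Q_Suc[of 0] by (simp add: sqrt_pq_eq P_Suc P_0 Q_0)
  next
    case (Suc i)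
    define a b c d where "a = conv_num D i" and "b = conv_den D i"
      and "c = conv_num D (Suc i)" and "d = conv_den D (Suc i)"
    define w where "w = u (Suc i)"
    have step: "conv_num D (Suc (Suc i)) = w * c + a" "conv_den D (Suc (Suc i)) = w * d + b"
      by (simp_all add: a_def b_def c_def d_def w_def sqrt_pq_eq)
    define e :: int where "e = (-1) ^ i"
    have IH: "a\<^sup>2 - int D * b\<^sup>2 = e * Q i" "a * c - int D * b * d = e * P (Suc i)"
      "a * d - b * c = e" "c\<^sup>2 - int D * d\<^sup>2 = - e * Q (Suc i)"
      using Suc by (simp_all add: a_def b_def c_def d_def e_def)
    have P2: "P (Suc (Suc i)) = w * Q (Suc i) - P (Suc i)" by (simp add: P_Suc w_def)
    have Q2: "Q (Suc (Suc i)) = Q i + w * (P (Suc i) - P (Suc (Suc i)))"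
      by (simp add: Q_Suc_Suc w_def)
    have "c * (w * c + a) - int D * d * (w * d + b) = - e * P (Suc (Suc i))"
      using IH P2 by Groebner_Basis.algebra
    moreover have "c * (w * d + b) - d * (w * c + a) = - e"
      using IH(3) by (simp add: algebra_simps)
    moreover have "(w * c + a)\<^sup>2 - int D * (w * d + b)\<^sup>2 = e * Q (Suc (Suc i))"
      using IH P2 Q2 by Groebner_Basis.algebra
    ultimately show ?case
      using IH(4) unfolding step c_def[symmetric] d_def[symmetric] by (simp add: e_def)
  qed
  then show "A\<^sup>2 - int D * B\<^sup>2 = (-1) ^ i * Q i"
    "A * A' - int D * B * B' = (-1) ^ i * P (Suc i)"
    "A * B' - B * A' = (-1) ^ i" "A'\<^sup>2 - int D * B'\<^sup>2 = (-1) ^ Suc i * Q (Suc i)"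
    by blast+
qed

text \<open>
  The norm form in the basis \<open>\<alpha>\<^bsub>i-1\<^esub>, \<alpha>\<^sub>i\<close>, up to the sign \<open>(-1)\<^sup>i\<close>.
\<close>

definition cf_form :: "nat \<Rightarrow> int \<Rightarrow> int \<Rightarrow> int" where
  "cf_form i x y = Q i * x\<^sup>2 + 2 * P (Suc i) * x * y - Q (Suc i) * y\<^sup>2"

lemma norm_convergent_combination:
  "(x * conv_num D i + y * conv_num D (Suc i))\<^sup>2
     - int D * (x * conv_den D i + y * conv_den D (Suc i))\<^sup>2 = (-1) ^ i * cf_form i x y"
proof -
  define e :: int where "e = (-1) ^ i"
  define a b c d where "a = conv_num D i" and "b = conv_den D i"
    and "c = conv_num D (Suc i)" and "d = conv_den D (Suc i)"
  have "a\<^sup>2 - int D * b\<^sup>2 = e * Q i" "a * c - int D * b * d = e * P (Suc i)"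
    "c\<^sup>2 - int D * d\<^sup>2 = - e * Q (Suc i)"
    using convergent_invariants[of i] by (simp_all add: a_def b_def c_def d_def e_def)
  then have "(x * a + y * c)\<^sup>2 - int D * (x * b + y * d)\<^sup>2 = e * cf_form i x y"
    unfolding cf_form_def by Groebner_Basis.algebra
  then show ?thesis by (simp add: a_def b_def c_def d_def e_def)
qed

text \<open>
  The base change \<open>\<alpha>\<^bsub>i+1\<^esub> = \<alpha>\<^bsub>i-1\<^esub> + u\<^bsub>i+1\<^esub>\<alpha>\<^sub>i\<close>, which is one step of Euclid's algorithm on the
  coordinates.
\<close>

lemma cf_form_step: "cf_form i x (z + u (Suc i) * x) = - cf_form (Suc i) z x"
  unfolding cf_form_def using Q_Suc_Suc[of i] P_Suc[of "Suc i"] by Groebner_Basis.algebra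

text \<open>
  A formula for the norm on the cone spanned by \<open>\<alpha>\<^bsub>i-1\<^esub>\<close> and \<open>\<alpha>\<^bsub>i+1\<^esub>\<close>, where \<open>0 \<le> y \<le> u\<^bsub>i+1\<^esub>x\<close>.  For
  \<open>x = 1\<close> it is the linear interpolation between the norms of the two generators, up to sign, plus a
  correction which is nonnegative on the cone.
\<close>

lemma cf_form_cone:
  defines "w i \<equiv> u (Suc i)"
  shows "w i * cf_form i x y =
    x * ((w i * x - y) * Q i + y * Q (Suc (Suc i))) + w i * Q (Suc i) * (y * (w i * x - y))"
  unfolding cf_form_def w_def using Q_Suc_Suc[of i] P_Suc[of "Suc i"] by Groebner_Basis.algebra

text \<open>
  From \<open>P\<^bsub>i+1\<^esub> + Q\<^sub>i > s\<close> and \<open>Q\<^sub>i Q\<^bsub>i+1\<^esub> = D - P\<^bsub>i+1\<^esub>\<^sup>2\<close> one gets \<open>Q\<^bsub>i+1\<^esub> \<le> s + P\<^bsub>i+1\<^esub>\<close>, so the complete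
  quotient with index \<open>i + 1\<close> is at least 1.
\<close>

lemma u_pos: "0 < u (Suc i)"
proof -
  have "(s + 1 - P (Suc i)) * Q (Suc i) \<le> Q i * Q (Suc i)"
    using P_gt[of i] Q_pos[of "Suc i"] by (intro mult_right_mono) auto
  also have "\<dots> < (s + 1 - P (Suc i)) * (s + 1 + P (Suc i))"
    using s_upper unfolding Q_Suc by (simp add: algebra_simps power2_eq_square)
  finally have "Q (Suc i) < s + 1 + P (Suc i)"
    using P_le[of i] by (simp add: mult_less_cancel_left)
  then have "0 < u (Suc i) * Q (Suc i)"
    using P_Suc[of "Suc i"] P_gt[of "Suc i"] by simp
  then show ?thesis using Q_pos[of "Suc i"] by (simp add: zero_less_mult_iff)
qed

lemma irrational: "sqrt (real D) \<notin> \<rat>"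
proof
  assume "sqrt (real D) \<in> \<rat>"
  moreover have "algebraic_int (sqrt (real D))" by (intro algebraic_int_sqrt) simp
  ultimately have "sqrt (real D) \<in> \<int>" by (rule rational_algebraic_int_is_int[rotated])
  then obtain k where "sqrt (real D) = of_int k" by (elim Ints_cases)
  with floor_sqrt_bounds[OF s_nonneg s_lower s_upper]
  have "real_of_int s < of_int k" "real_of_int k < of_int (s + 1)" by simp_all
  then show False by (simp only: of_int_less_iff)
qed

text \<open>
  Euclid's algorithm on the coordinates, with \<open>cf_form_step\<close> adapting the basis, stops in the cone of
  some \<open>\<alpha>\<^bsub>i-1\<^esub>, \<alpha>\<^bsub>i+1\<^esub>\<close>; the sign of the value forces \<open>i\<close> to be odd.  There \<open>cf_form_cone\<close> bounds the
  value from below: by \<open>4n\<close> if \<open>x \<ge> 2\<close>, by \<open>n + Q\<^bsub>i+1\<^esub>(u\<^bsub>i+1\<^esub> - 1)\<close> for a proper semiconvergent, where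
  \<open>x = 1\<close> and \<open>0 < y < u\<^bsub>i+1\<^esub>\<close>, and for \<open>\<alpha>\<^bsub>i-1\<^esub>\<close> itself it is \<open>Q\<^sub>i\<close>.
\<close>

lemma negative_form_value:
  assumes "0 < n" "n \<le> K" "K \<le> 4 * n"
    and odd: "\<And>j. odd j \<Longrightarrow> Q j = n \<or> K \<le> Q j"
    and even: "\<And>j. odd j \<Longrightarrow> u (Suc j) = 1 \<or> K \<le> n + Q (Suc j) * (u (Suc j) - 1)"
    and "0 \<le> x" "0 \<le> y" "(-1) ^ i * cf_form i x y = - v" "0 < v"
  shows "v = n \<or> K \<le> v"
  using assms(6-8)
  \<comment> \<open>Weight 2 on \<open>y\<close> makes the measure drop also when \<open>x = 0\<close>, where a step just swaps the coordinates.\<close>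
proof (induction "nat (x + 2 * y)" arbitrary: i x y rule: less_induct)
  case less
  define w where "w = u (Suc i)"
  have "w > 0" using u_pos by (simp add: w_def)
  show ?case
  proof (cases "y < w * x")
    case False
    define z where "z = y - w * x"
    have "z \<ge> 0" "y = z + u (Suc i) * x" using False by (simp_all add: z_def w_def)
    have "x \<le> w * x" using \<open>w > 0\<close> less.prems(1) by (simp add: mult_le_cancel_right1)
    have "y \<noteq> 0"
    proof
      assume "y = 0"
      with \<open>x \<le> w * x\<close> False less.prems(1) have "x = 0" by linarith
      with \<open>y = 0\<close> less.prems(3) \<open>0 < v\<close> show False by (simp add: cf_form_def)
    qed
    show ?thesis
    proof (rule less.hyps[of z x "Suc i"])
      show "nat (z + 2 * x) < nat (x + 2 * y)"
        using \<open>x \<le> w * x\<close> \<open>y \<noteq> 0\<close> less.prems(1,2) by (simp add: z_def)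
      show "(-1) ^ Suc i * cf_form (Suc i) z x = - v"
        using less.prems(3) cf_form_step[of i x z] \<open>y = z + u (Suc i) * x\<close> by simp
    qed (use \<open>z \<ge> 0\<close> less.prems in auto)
  next
    case True
    have "x \<noteq> 0" using True less.prems(2) by auto
    with less.prems(1) have "x \<ge> 1" by simp
    define F where "F = cf_form i x y"
    define t where "t = y * (w * x - y)"
    have "t \<ge> 0" using True less.prems(2) by (simp add: t_def)
    have cone: "w * F = x * ((w * x - y) * Q i + y * Q (Suc (Suc i))) + w * Q (Suc i) * t"
      using cf_form_cone[of i x y] by (simp add: w_def F_def t_def)
    have "0 < (w * x - y) * Q i" using True Q_pos[of i] by simp
    moreover have "0 \<le> y * Q (Suc (Suc i))" using less.prems(2) Q_pos[of "Suc (Suc i)"] by simp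
    moreover have "0 \<le> w * Q (Suc i) * t" using \<open>w > 0\<close> Q_pos[of "Suc i"] \<open>t \<ge> 0\<close> by simp
    moreover have "0 < x * ((w * x - y) * Q i + y * Q (Suc (Suc i)))"
      using calculation(1,2) \<open>x \<ge> 1\<close> by (intro mult_pos_pos[OF _ add_pos_nonneg]) simp_all
    ultimately have "0 < w * F" unfolding cone by simp
    then have "F > 0" using \<open>w > 0\<close> by (simp add: zero_less_mult_iff)
    have "odd i" and "F = v"
      using less.prems(3) \<open>F > 0\<close> \<open>0 < v\<close> by (cases "even i"; simp add: F_def)+
    have Qn: "n \<le> Q i" "n \<le> Q (Suc (Suc i))"
      using odd[of i] odd[of "Suc (Suc i)"] \<open>odd i\<close> \<open>n \<le> K\<close> by auto
    have "w * (n * x\<^sup>2 + Q (Suc i) * t) = x * ((w * x - y) * n + y * n) + w * Q (Suc i) * t"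
      by (simp add: algebra_simps power2_eq_square)
    also have "\<dots> \<le> w * F"
      unfolding cone using Qn True less.prems(1,2)
      by (intro add_right_mono mult_left_mono add_mono) auto
    finally have bound: "n * x\<^sup>2 + Q (Suc i) * t \<le> v"
      using \<open>w > 0\<close> \<open>F = v\<close> by simp
    have Qt: "0 \<le> Q (Suc i) * t" using Q_pos[of "Suc i"] \<open>t \<ge> 0\<close> by simp
    consider "x \<ge> 2" | "x = 1" "y = 0" | "x = 1" "y \<ge> 1" using \<open>x \<ge> 1\<close> less.prems(2) by linarith
    then show ?thesis
    proof cases
      case 1
      then have "n * 2\<^sup>2 \<le> n * x\<^sup>2" using \<open>0 < n\<close> by (intro mult_left_mono power_mono) auto
      with bound Qt \<open>K \<le> 4 * n\<close> show ?thesis by simp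
    next
      case 2
      then have "v = Q i" using \<open>F = v\<close> by (simp add: F_def cf_form_def)
      with odd[OF \<open>odd i\<close>] show ?thesis by simp
    next
      case 3
      then have "y \<le> w - 1" using True by simp
      then have "0 \<le> (y - 1) * (w - 1 - y)" using 3 by simp
      also have "\<dots> = t - (w - 1)" using 3 by (simp add: t_def algebra_simps)
      finally have "Q (Suc i) * (w - 1) \<le> Q (Suc i) * t" using Q_pos[of "Suc i"] by simp
      moreover have "K \<le> n + Q (Suc i) * (w - 1)"
        using even[OF \<open>odd i\<close>] 3 \<open>y \<le> w - 1\<close> by (auto simp: w_def)
      ultimately show ?thesis using bound 3 by simp
    qed
  qed
qed

text \<open>
  Up to the signs of the coordinates, an element of negative norm is a nonnegative combination of
  \<open>\<alpha>\<^bsub>-1\<^esub> = 1\<close> and \<open>\<alpha>\<^sub>0 = s + \<surd>D\<close>, unless it lies between \<open>\<surd>D\<close> and \<open>\<alpha>\<^sub>0\<close>.  In that case its norm has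
  absolute value at least \<open>2s\<close>, because \<open>D > s\<^sup>2\<close>.
\<close>

theorem negative_norm_value:
  assumes "0 < n" "n \<le> K" "K \<le> 4 * n" "K \<le> 2 * s"
    and "\<And>j. odd j \<Longrightarrow> Q j = n \<or> K \<le> Q j"
    and "\<And>j. odd j \<Longrightarrow> u (Suc j) = 1 \<or> K \<le> n + Q (Suc j) * (u (Suc j) - 1)"
    and neg: "x\<^sup>2 < int D * y\<^sup>2"
  shows "int D * y\<^sup>2 - x\<^sup>2 = n \<or> K \<le> int D * y\<^sup>2 - x\<^sup>2"
proof (cases "s * \<bar>y\<bar> \<le> \<bar>x\<bar>")
  case True
  have "(-1) ^ 0 * cf_form 0 (\<bar>x\<bar> - s * \<bar>y\<bar>) \<bar>y\<bar> = - (int D * y\<^sup>2 - x\<^sup>2)"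
  proof -
    have "cf_form 0 (\<bar>x\<bar> - s * \<bar>y\<bar>) \<bar>y\<bar> = \<bar>x\<bar>\<^sup>2 - int D * \<bar>y\<bar>\<^sup>2"
      unfolding cf_form_def P_1 Q_0 using Q_Suc[of 0] unfolding P_1 Q_0 by Groebner_Basis.algebra
    then show ?thesis by simp
  qed
  with True neg show ?thesis
    by (intro negative_form_value[OF assms(1-3,5,6), of "\<bar>x\<bar> - s * \<bar>y\<bar>" "\<bar>y\<bar>" 0]) auto
next
  case False
  have "y \<noteq> 0" using neg by auto
  then have "\<bar>y\<bar> \<ge> 1" by simp
  have "\<bar>x\<bar>\<^sup>2 \<le> (s * \<bar>y\<bar> - 1)\<^sup>2" using False by (intro power_mono) auto
  then have "x\<^sup>2 \<le> s\<^sup>2 * y\<^sup>2 - 2 * (s * \<bar>y\<bar>) + 1" by (simp add: power2_diff power_mult_distrib)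
  moreover have "(s\<^sup>2 + 1) * y\<^sup>2 \<le> int D * y\<^sup>2" using s_lower by (intro mult_right_mono) auto
  moreover have "1 \<le> y\<^sup>2" using \<open>y \<noteq> 0\<close> by (simp add: int_one_le_iff_zero_less)
  moreover have "s * 1 \<le> s * \<bar>y\<bar>" using \<open>\<bar>y\<bar> \<ge> 1\<close> s_nonneg by (intro mult_left_mono) auto
  ultimately have "2 * s \<le> int D * y\<^sup>2 - x\<^sup>2" by (simp add: algebra_simps)
  with \<open>K \<le> 2 * s\<close> show ?thesis by simp
qed

lemma conv_num_pos: "0 < s \<Longrightarrow> 0 < conv_num D i"
proof (induction i rule: induct_nat_012)
  case 1
  then show ?case using P_Suc[of 0] by (simp add: sqrt_pq_eq P_0 Q_0 P_1)
next
  case (ge2 i)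
  then show ?case using u_pos[of i] by (simp add: sqrt_pq_eq add_pos_pos)
qed simp

lemma semiconv_elem_coords:
  "semiconv_elem D (int i - 1) r =
     of_int (conv_num D i + r * conv_num D (Suc i)) +
     of_int (conv_den D i + r * conv_den D (Suc i)) * sqrt (real D)"
  by (simp add: semiconv_elem_def conv_elem_def algebra_simps nat_add_distrib)

lemma quad_norm_conv_elem:
  "quad_norm D (conv_elem D (int i - 1)) = of_int ((-1) ^ i * Q i)"
  by (simp only: conv_elem_def diff_add_cancel nat_int quad_norm_int[OF irrational]
      convergent_invariants(1))

lemma quad_norm_semiconv_elem:
  "quad_norm D (semiconv_elem D (int i - 1) r) = of_int ((-1) ^ i * cf_form i 1 r)"
  unfolding semiconv_elem_coords quad_norm_int[OF irrational]
  using norm_convergent_combination[of 1 i r] by simp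

text \<open>
  The companion of \<open>\<alpha>\<^bsub>i-1,r\<^esub> = \<alpha>\<^bsub>i-1\<^esub> + r\<alpha>\<^sub>i\<close> is \<open>\<alpha>\<^sub>i\<close>, whose norm is negative for even \<open>i\<close>.
\<close>

lemma semiconvergent_indecomposable:
  assumes "squarefree D" "D mod 4 = 2 \<or> D mod 4 = 3" "0 < s"
    and "even i" "0 \<le> r" "r \<le> u (Suc i)"
  shows "indecomposable D (semiconv_elem D (int i - 1) r)"
proof -
  define x y where "x = conv_num D i + r * conv_num D (Suc i)"
    and "y = conv_den D i + r * conv_den D (Suc i)"
  define w where "w = u (Suc i)"
  have "w > 0" using u_pos by (simp add: w_def)
  have "0 < (w - r) * Q i + r * Q (Suc (Suc i))"
  proof (cases "r = w")
    case True
    with \<open>w > 0\<close> Q_pos[of "Suc (Suc i)"] show ?thesis by simp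
  next
    case False
    with assms(5,6) Q_pos[of i] Q_pos[of "Suc (Suc i)"] show ?thesis
      by (intro add_pos_nonneg) (auto simp: w_def)
  qed
  moreover have "0 \<le> w * Q (Suc i) * (r * (w - r))"
    using \<open>w > 0\<close> Q_pos[of "Suc i"] assms(5,6) by (simp add: w_def)
  ultimately have "0 < w * cf_form i 1 r"
    using cf_form_cone[of i 1 r] by (simp add: w_def)
  then have "0 < cf_form i 1 r" using \<open>w > 0\<close> by (simp add: zero_less_mult_iff)
  then have "int D * y\<^sup>2 < x\<^sup>2"
    using norm_convergent_combination[of 1 i r] \<open>even i\<close> by (simp add: x_def y_def)
  moreover have "0 < x"
    using conv_num_pos[OF \<open>0 < s\<close>, of i] conv_num_pos[OF \<open>0 < s\<close>, of "Suc i"] \<open>0 \<le> r\<close>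
    by (simp add: x_def add_pos_nonneg)
  ultimately have "tot_pos D x y" by (simp add: tot_pos_def)
  moreover have "x * conv_den D (Suc i) - y * conv_num D (Suc i) = 1"
    using convergent_invariants(3)[of i] \<open>even i\<close> by (simp add: x_def y_def algebra_simps)
  moreover have "(conv_num D (Suc i))\<^sup>2 < int D * (conv_den D (Suc i))\<^sup>2"
    using convergent_invariants(4)[of i] \<open>even i\<close> Q_pos[of "Suc i"] by simp
  ultimately show ?thesis
    unfolding semiconv_elem_coords x_def[symmetric] y_def[symmetric]
      indecomposable_int[OF assms(1,2)]
    using not_decomposable[of x "conv_den D (Suc i)" y "conv_num D (Suc i)" D] by auto
qed

end

section \<open>The smallest negative norm\<close>

lemma negative_norm_of_quad_order:
  assumes irr: "sqrt (real D) \<notin> \<rat>" and "\<alpha> \<in> quad_order D" "quad_norm D \<alpha> < 0"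
  obtains x y :: int where "x\<^sup>2 < int D * y\<^sup>2" "quad_norm D \<alpha> = - of_int (int D * y\<^sup>2 - x\<^sup>2)"
proof -
  obtain x y :: int where "\<alpha> = of_int x + of_int y * sqrt (real D)"
    using assms(2) by (auto simp: quad_order_def)
  then have norm: "quad_norm D \<alpha> = of_int (x\<^sup>2 - int D * y\<^sup>2)" by (simp only: quad_norm_int[OF irr])
  with assms(3) have "x\<^sup>2 - int D * y\<^sup>2 < 0" by (simp only: of_int_less_0_iff)
  with norm show thesis by (intro that[of x y]) simp_all
qed

lemma min_neg_norm_eq:
  assumes irr: "sqrt (real D) \<notin> \<rat>" and "\<alpha> \<in> quad_order D" "quad_norm D \<alpha> = - real n" "0 < n"
    and "\<And>x y. x\<^sup>2 < int D * y\<^sup>2 \<Longrightarrow> int n \<le> int D * y\<^sup>2 - x\<^sup>2"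
  shows "min_neg_norm D = n"
  unfolding min_neg_norm_def
proof (rule Least_equality)
  show "\<exists>\<alpha>\<in>quad_order D. quad_norm D \<alpha> < 0 \<and> real n = \<bar>quad_norm D \<alpha>\<bar>"
    using assms(2-4) by (intro bexI[of _ \<alpha>]) auto
next
  fix k assume "\<exists>\<alpha>\<in>quad_order D. quad_norm D \<alpha> < 0 \<and> real k = \<bar>quad_norm D \<alpha>\<bar>"
  then obtain \<beta> where \<beta>: "\<beta> \<in> quad_order D" "quad_norm D \<beta> < 0" "real k = - quad_norm D \<beta>" by auto
  obtain x y :: int where xy: "x\<^sup>2 < int D * y\<^sup>2" "quad_norm D \<beta> = - of_int (int D * y\<^sup>2 - x\<^sup>2)"
    using negative_norm_of_quad_order[OF irr \<beta>(1,2)] .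
  then have "real_of_int (int k) = of_int (int D * y\<^sup>2 - x\<^sup>2)" using \<beta>(3) by simp
  then have "int k = int D * y\<^sup>2 - x\<^sup>2" by (simp only: of_int_eq_iff)
  with assms(5)[OF xy(1)] show "n \<le> k" by simp
qed

section \<open>Primes and square roots modulo primes\<close>

text \<open>
  Modulo a prime, \<open>\<plusminus>a\<close> are the only square roots of \<open>a\<^sup>2\<close>.
\<close>

lemma square_root_mod_prime_lower:
  fixes a m c :: int
  assumes "prime n" "n dvd c - a\<^sup>2" "n dvd c - m\<^sup>2" "0 \<le> a" "2 * a < n"
  shows "a \<le> \<bar>m\<bar>"
proof (rule ccontr)
  assume "\<not> a \<le> \<bar>m\<bar>"
  have "n dvd (c - m\<^sup>2) - (c - a\<^sup>2)" using assms(3,2) by (rule dvd_diff)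
  also have "(c - m\<^sup>2) - (c - a\<^sup>2) = (a - \<bar>m\<bar>) * (a + \<bar>m\<bar>)"
    by (simp add: algebra_simps flip: power2_eq_square)
  finally have "n dvd a - \<bar>m\<bar> \<or> n dvd a + \<bar>m\<bar>" using assms(1) by (simp add: prime_dvd_mult_iff)
  moreover have "0 < a - \<bar>m\<bar>" "a - \<bar>m\<bar> < n" "0 < a + \<bar>m\<bar>" "a + \<bar>m\<bar> < n"
    using \<open>\<not> a \<le> \<bar>m\<bar>\<close> assms(4,5) by simp_all
  ultimately show False using zdvd_not_zless by blast
qed

text \<open>
  Pocklington's criterion: if \<open>b\<close> has order exactly \<open>q\<close> modulo every prime divisor of \<open>n\<close>, which
  the gcd conditions guarantee, then all these divisors are \<open>1\<close> modulo \<open>q \<ge> sqrt n\<close>, so that none is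
  at most \<open>sqrt n\<close>.  The conditions are phrased with \<open>mod_exp\<close> and \<open>gcd\<close> because the simplifier can
  evaluate both, by repeated squaring and by Euclid's algorithm.
\<close>

lemma pocklington_mod_exp:
  fixes n :: nat
  assumes "\<forall>p\<in>set ps. prime p"
    and "\<forall>p\<in>set ps. gcd (mod_exp b (q div p) n - 1) n = 1"
    and "prod_list ps = q" "q * r = n - 1" "n \<le> q\<^sup>2" "2 \<le> n"
    and "mod_exp a r n = b" "mod_exp b q n = 1"
  shows "prime n"
  using assms by (intro pocklington_primefact[of n q r a b ps])
    (auto simp: mod_exp_def list_all_iff coprime_iff_gcd_eq_1 prod_list.eq_foldr)

lemma prime_16057: "prime (16057 :: nat)"
proof (rule pocklington_mod_exp[where q = 223 and r = 72 and a = 2 and b = 8250])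
  show "\<forall>p\<in>set [223]. prime (p :: nat)"
    by simp
qed (simp_all add: gcd_non_0_nat)

lemma prime_24548583881: "prime (24548583881 :: nat)"
proof (rule pocklington_mod_exp[where q = 594109 and r = 41320 and a = 2 and b = 3748096205])
  have "prime (37 :: nat)" by simp
  then show "\<forall>p\<in>set [37, 16057]. prime (p :: nat)"
    using prime_16057 by (simp del: prime_nat_numeral_eq)
qed (simp_all add: gcd_non_0_nat)

lemma prime_1489: "prime (1489 :: nat)"
proof (rule pocklington_mod_exp[where q = 62 and r = 24 and a = 7 and b = 746])
  show "\<forall>p\<in>set [2, 31]. prime (p :: nat)"
    by simp
qed (simp_all add: gcd_non_0_nat)

lemma prime_67710787: "prime (67710787 :: nat)"
proof (rule pocklington_mod_exp[where q = 16379 and r = 4134 and a = 2 and b = 54088480])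
  have "prime (11 :: nat)" by simp
  then show "\<forall>p\<in>set [11, 1489]. prime (p :: nat)"
    using prime_1489 by (simp del: prime_nat_numeral_eq)
qed (simp_all add: gcd_non_0_nat)

lemma prime_10429: "prime (10429 :: nat)"
proof (rule pocklington_mod_exp[where q = 158 and r = 66 and a = 2 and b = 6513])
  show "\<forall>p\<in>set [2, 79]. prime (p :: nat)"
    by simp
qed (simp_all add: gcd_non_0_nat)

lemma prime_1355771: "prime (1355771 :: nat)"
proof (rule pocklington_mod_exp[where q = 10429 and r = 130 and a = 2 and b = 522411])
  show "\<forall>p\<in>set [10429]. prime (p :: nat)"
    using prime_10429 by (simp del: prime_nat_numeral_eq)
qed (simp_all add: gcd_non_0_nat)

lemma prime_7219: "prime (7219 :: nat)"
proof (rule pocklington_mod_exp[where q = 401 and r = 18 and a = 2 and b = 2260])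
  show "\<forall>p\<in>set [401]. prime (p :: nat)"
    by simp
qed (simp_all add: gcd_non_0_nat)

lemma prime_1811: "prime (1811 :: nat)"
proof (rule pocklington_mod_exp[where q = 181 and r = 10 and a = 2 and b = 1024])
  show "\<forall>p\<in>set [181]. prime (p :: nat)"
    by simp
qed (simp_all add: gcd_non_0_nat)

lemma prime_3623: "prime (3623 :: nat)"
proof (rule pocklington_mod_exp[where q = 1811 and r = 2 and a = 2 and b = 4])
  show "\<forall>p\<in>set [1811]. prime (p :: nat)"
    using prime_1811 by (simp del: prime_nat_numeral_eq)
qed (simp_all add: gcd_non_0_nat)

lemma squarefree_discriminant: "squarefree (24009857226825282345490 :: nat)"
proof -
  let ?S = "{2, 5, 3623, 7219, 1355771, 67710787 :: nat}"
  have "prime (2 :: nat)" "prime (5 :: nat)" by simp_all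
  then have "\<forall>p\<in>?S. prime p"
    using prime_3623 prime_7219 prime_1355771 prime_67710787 by blast
  then have "squarefree (\<Prod>p\<in>?S. p)"
    by (intro squarefree_prod_coprime squarefree_prime primes_coprime) blast+
  then show ?thesis by simp
qed

section \<open>The expansion of the square root of 24009857226825282345490\<close>

text \<open>
  Entry \<open>j\<close> of the three lists is \<open>P\<^bsub>j+1\<^esub>\<close>, \<open>Q\<^sub>j\<close> and \<open>u\<^bsub>j+1\<^esub>\<close> respectively: \<open>Q\<close> is periodic from index 0 on,
  whereas \<open>P\<close> and \<open>u\<close> are periodic only from index 1 on.
\<close>

definition period_P :: "int list" where
  "period_P =
    [154951144645, 140750550005, 143261342797, 151321663775, 120370904215, 89882237026,
     137430048536, 133008778308, 147358749990, 147358749990, 133008778308, 137430048536,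
     89882237026, 120370904215, 151321663775, 143261342797, 140750550005, 154951144645]"

definition period_Q :: "int list" where
  "period_Q =
    [1, 29570169465, 142005946401, 24548583881, 45282094665, 210253141241,
     75770761854, 67609706711, 93455842766, 24559791665, 93455842766, 67609706711,
     75770761854, 210253141241, 45282094665, 24548583881, 142005946401, 29570169465]"

definition period_u :: "int list" where
  "period_u = [10, 2, 12, 6, 1, 3, 4, 3, 12, 3, 4, 3, 1, 6, 12, 2, 10, 309902289290]"

definition cf_P :: "nat \<Rightarrow> int" where
  "cf_P i = (if i = 0 then 0 else period_P ! ((i - 1) mod 18))"

definition cf_Q :: "nat \<Rightarrow> int" where
  "cf_Q i = period_Q ! (i mod 18)"

definition cf_u :: "nat \<Rightarrow> int" where
  "cf_u i = (if i = 0 then 154951144645 else period_u ! ((i - 1) mod 18))"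

lemma periodic_Suc:
  "cf_P (Suc i) = period_P ! (i mod 18)" "cf_u (Suc i) = period_u ! (i mod 18)"
  by (simp_all add: cf_P_def cf_u_def)

lemma mod_18_mem: "i mod 18 \<in> set [0..<18]"
  unfolding set_upt by simp

lemma period_check:
  "\<forall>j\<in>set [0..<18].
     period_P ! (Suc j mod 18) = period_u ! j * period_Q ! (Suc j mod 18) - period_P ! j \<and>
     period_Q ! j * period_Q ! (Suc j mod 18) = 24009857226825282345490 - (period_P ! j)\<^sup>2 \<and>
     0 < period_Q ! j \<and> period_P ! j \<le> 154951144645 \<and>
     154951144645 < period_P ! j + period_Q ! j"
  by (simp add: upt_rec period_P_def period_Q_def period_u_def del: set_upt)

text \<open>
  The numerical facts behind \<open>negative_norm_value\<close>: on convergents of negative norm, the smallest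
  absolute value is \<open>24548583881 = Q\<^sub>3\<close>, the next one is \<open>24559791665 = Q\<^sub>9\<close>, and proper semiconvergents
  do not fall below the latter.
\<close>

lemma odd_period_check:
  "\<forall>j\<in>set [0..<18]. odd j \<longrightarrow>
     (period_Q ! j = 24548583881 \<or> 24559791665 \<le> period_Q ! j) \<and>
     (period_u ! j = 1 \<or>
      24559791665 \<le> 24548583881 + period_Q ! (Suc j mod 18) * (period_u ! j - 1))"
  by (simp add: upt_rec period_P_def period_Q_def period_u_def del: set_upt)

lemma sqrt_expansion_24009857226825282345490:
  assumes "D = 24009857226825282345490"
  shows "sqrt_expansion D 154951144645 cf_P cf_Q cf_u"
proof
  fix i :: nat
  show "cf_P (Suc i) = cf_u i * cf_Q i - cf_P i"
  proof (cases i)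
    case 0
    then show ?thesis by (simp add: cf_P_def cf_Q_def cf_u_def period_P_def period_Q_def)
  next
    case (Suc k)
    then show ?thesis
      using bspec[OF period_check mod_18_mem[of k]]
      by (simp only: periodic_Suc cf_Q_def mod_Suc_eq)
  qed
  show "cf_Q i * cf_Q (Suc i) = int D - (cf_P (Suc i))\<^sup>2" "0 < cf_Q i"
    "cf_P (Suc i) \<le> 154951144645" "154951144645 < cf_P (Suc i) + cf_Q i"
    using bspec[OF period_check mod_18_mem[of i]] assms
    by (simp_all add: periodic_Suc cf_Q_def mod_Suc_eq del: set_upt)
qed (simp_all add: assms cf_P_def cf_Q_def period_Q_def)

section \<open>The counterexample\<close>

theorem theorem4:
  fixes D :: nat
  assumes D: "D = 24009857226825282345490"
  shows
    "(D mod 4 = 2 \<and> squarefree D \<and>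
     sqrt_pq D 0 = 154951144645 \<and>
     (\<forall>j. sqrt_pq D (Suc j) =
        [10, 2, 12, 6, 1, 3, 4, 3, 12, 3, 4, 3, 1, 6, 12, 2, 10, 2 * sqrt_pq D 0] ! (j mod 18))) \<and>
     (conv_elem D 2 \<in> quad_order D \<and> quad_norm D (conv_elem D 2) < 0 \<and>
     (\<forall>\<alpha> \<in> quad_order D. quad_norm D \<alpha> < 0 \<longrightarrow> quad_norm D \<alpha> \<le> quad_norm D (conv_elem D 2)) \<and>
     quad_norm D (conv_elem D 2) = - real (min_neg_norm D) \<and>
     - real (min_neg_norm D) = - conv_norm D 2 \<and>
     - conv_norm D 2 = - 24548583881) \<and>
     (indecomposable D (semiconv_elem D 7 6) \<and>
     (\<forall>\<alpha>. indecomposable D \<alpha> \<longrightarrow> quad_norm D \<alpha> \<le> quad_norm D (semiconv_elem D 7 6)) \<and>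
     quad_norm D (semiconv_elem D 7 6) = mid_norm D 7 \<and>
     mid_norm D 7 = 977608342706) \<and>
     least_root D 4030160489 \<and>
     (mid_norm D 7 = 977608342706 \<and>
     mid_norm D 7 > (real D - 4030160489\<^sup>2) / real (min_neg_norm D) \<and>
     (real D - 4030160489\<^sup>2) / real (min_neg_norm D) = mid_norm D 1 \<and>
     mid_norm D 1 = 977393040249) \<and>
     \<not> jang_kim D"
proof -
  interpret sqrt_expansion D 154951144645 cf_P cf_Q cf_u
    using D by (rule sqrt_expansion_24009857226825282345490)
  have mod4: "D mod 4 = 2" and sf: "squarefree D"
    using squarefree_discriminant by (simp_all add: D)
  note tables = cf_P_def cf_Q_def cf_u_def period_P_def period_Q_def period_u_def

  have odd_Q: "cf_Q j = 24548583881 \<or> 24559791665 \<le> cf_Q j" if "odd j" for j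
    using bspec[OF odd_period_check mod_18_mem[of j]] that
    by (simp add: cf_Q_def dvd_mod_iff del: set_upt)
  have odd_u: "cf_u (Suc j) = 1 \<or>
      24559791665 \<le> 24548583881 + cf_Q (Suc j) * (cf_u (Suc j) - 1)" if "odd j" for j
    using bspec[OF odd_period_check mod_18_mem[of j]] that
    by (simp add: cf_Q_def periodic_Suc mod_Suc_eq dvd_mod_iff del: set_upt)
  have neg: "int D * y\<^sup>2 - x\<^sup>2 = 24548583881 \<or> 24559791665 \<le> int D * y\<^sup>2 - x\<^sup>2"
    if "x\<^sup>2 < int D * y\<^sup>2" for x y :: int
    by (rule negative_norm_value) (use that odd_Q odd_u in auto)
  have neg_ge: "24548583881 \<le> int D * y\<^sup>2 - x\<^sup>2" if "x\<^sup>2 < int D * y\<^sup>2" for x y :: int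
    using neg[OF that] by linarith

  have norm_2: "quad_norm D (conv_elem D 2) = - 24548583881"
    using quad_norm_conv_elem[of 3] by (simp add: tables)
  have norm_7: "quad_norm D (semiconv_elem D 7 6) = 977608342706"
    using quad_norm_semiconv_elem[of 8 6] by (simp add: cf_form_def tables)
  have "cf_u 9 = 12" "cf_u 3 = 12" by (simp_all add: tables)
  then have mid_7: "mid_norm D 7 = 977608342706" and mid_1: "mid_norm D 1 = 977393040249"
    using norm_7 quad_norm_semiconv_elem[of 2 6]
    by (simp_all add: mid_norm_def sqrt_pq_eq cf_form_def tables)
  have order_2: "conv_elem D 2 \<in> quad_order D"
    unfolding quad_order_def conv_elem_def by blast
  have min: "min_neg_norm D = 24548583881"
    by (rule min_neg_norm_eq[OF irrational order_2]) (use neg_ge in \<open>simp_all add: norm_2\<close>)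

  have cf: "sqrt_pq D 0 = 154951144645 \<and>
     (\<forall>j. sqrt_pq D (Suc j) =
        [10, 2, 12, 6, 1, 3, 4, 3, 12, 3, 4, 3, 1, 6, 12, 2, 10, 2 * sqrt_pq D 0] ! (j mod 18))"
    by (simp add: sqrt_pq_eq periodic_Suc period_u_def) (simp add: cf_u_def)

  have largest: "quad_norm D \<alpha> \<le> quad_norm D (conv_elem D 2)"
    if "\<alpha> \<in> quad_order D" "quad_norm D \<alpha> < 0" for \<alpha>
  proof -
    obtain x y :: int where xy: "x\<^sup>2 < int D * y\<^sup>2"
      "quad_norm D \<alpha> = - of_int (int D * y\<^sup>2 - x\<^sup>2)"
      using negative_norm_of_quad_order[OF irrational \<open>\<alpha> \<in> quad_order D\<close> \<open>quad_norm D \<alpha> < 0\<close>] .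
    have "real_of_int 24548583881 \<le> of_int (int D * y\<^sup>2 - x\<^sup>2)"
      using neg_ge[OF xy(1)] by (simp only: of_int_le_iff)
    then show ?thesis by (simp add: norm_2 xy(2))
  qed

  have root: "24548583881 dvd int D - 4030160489\<^sup>2" by (simp add: D)
  have "prime (int 24548583881)"
    using prime_24548583881 by (simp only: prime_nat_int_transfer)
  then have "prime (24548583881 :: int)" by (simp only: of_nat_numeral)
  then have root_lower: "4030160489 \<le> \<bar>m\<bar>" if "24548583881 dvd int D - m\<^sup>2" for m :: int
    by (rule square_root_mod_prime_lower[OF _ root that]) simp_all
  have least: "least_root D 4030160489"
    unfolding least_root_def min
  proof (intro conjI allI impI)
    fix b :: nat assume "b < 4030160489"
    then show "\<not> int 24548583881 dvd int D - (int b)\<^sup>2"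
      using root_lower[of "int b"] by auto
  qed (use root in simp)

  have indec_7: "indecomposable D (semiconv_elem D 7 6)"
    using semiconvergent_indecomposable[OF sf disjI1[OF mod4], of 8 6] \<open>cf_u 9 = 12\<close> by simp
  have bound: "quad_norm D \<alpha> \<le> quad_norm D (semiconv_elem D 7 6)"
    if ind: "indecomposable D \<alpha>" for \<alpha>
  proof -
    obtain A m x y :: int where A: "quad_norm D \<alpha> = of_int A" "0 < A" "x\<^sup>2 < int D * y\<^sup>2"
      "A * (int D * y\<^sup>2 - x\<^sup>2) = int D - m\<^sup>2"
      using indecomposable_norm_factor[OF sf disjI1[OF mod4] ind] .
    define v where "v = int D * y\<^sup>2 - x\<^sup>2"
    have Av: "A * v = int D - m\<^sup>2" using A(4) by (simp add: v_def)
    from neg[OF A(3)] have "A \<le> 977608342706"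
    proof
      \<comment> \<open>Smallest negative norm: \<open>m\<close> is a square root of \<open>D\<close> modulo it, hence not small.\<close>
      assume "int D * y\<^sup>2 - x\<^sup>2 = 24548583881"
      then have v: "A * 24548583881 = int D - m\<^sup>2" using Av by (simp add: v_def)
      then have "24548583881 dvd int D - m\<^sup>2" by (metis dvd_triv_right)
      from power_mono[OF root_lower[OF this], of 2] have "4030160489\<^sup>2 \<le> m\<^sup>2" by simp
      with v show ?thesis by (simp add: D)
    next
      \<comment> \<open>Any other negative norm: \<open>m = 0\<close> is the worst case, since \<open>D\<close> is divisible by 24559791665.\<close>
      assume "24559791665 \<le> int D * y\<^sup>2 - x\<^sup>2"
      then have "A * 24559791665 \<le> A * v" using \<open>0 < A\<close> by (simp add: v_def)
      also have "\<dots> \<le> int D" unfolding Av by simp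
      also have "\<dots> = 977608342706 * 24559791665" by (simp add: D)
      finally show ?thesis by simp
    qed
    then show ?thesis by (simp add: A(1) norm_7)
  qed

  have quotient: "(real D - 4030160489\<^sup>2) / real (min_neg_norm D) = 977393040249"
    unfolding min by (simp add: D)
  have "\<not> jang_kim D"
  proof
    assume "jang_kim D"
    then have "quad_norm D (semiconv_elem D 7 6) \<le>
        (real D - (real 4030160489)\<^sup>2) / real (min_neg_norm D)"
      using least indec_7 unfolding jang_kim_def by blast
    with quotient show False by (simp add: norm_7)
  qed
  with mod4 sf cf order_2 largest norm_2 min least indec_7 bound norm_7 mid_7 mid_1 quotient
  show ?thesis
    by (intro conjI) (simp_all add: conv_norm_def)
qed

end
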